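(* Let $M$ be a monoid with identity $1$ and let $s(x,y)=(xy,\theta_x(y))$ be an idempotent solution on $M$ such that $\theta_1$ is a monoid homomorphism from $M$ to $E(M)$. Then: 1. $\theta_1(M)$ is a system of representatives of $M/\ker\theta_1$ that contains the identity; 2. $(\theta_x(y),y)\in\ker\theta_1$ for all $x,y\in M$.
   Context: For a semigroup $X$, a solution (set-theoretical solution of the pentagon equation) on $X$ is a map $s:X\times X\to X\times X$ of the form $s(x,y)=(xy,\theta_x(y))$, where $xy$ is the product in $X$ and $\theta_x:X\to X$ is a map for every $x\in X$, such that for all $x,y,z\in X$: $\theta_x(y)\,\theta_{xy}(z)=\theta_x(yz)$ and $\theta_{\theta_x(y)}\theta_{xy}=\theta_y$ (juxtaposition of maps is composition). The solution $s$ is idempotent if $s^2=s$. $E(M)$ denotes the set of idempotents of $M$; that $\theta_1$ is a monoid homomorphism from $M$ to $E(M)$ means that $\theta_1$ is a monoid homomorphism whose values lie in $E(M)$. $\ker\theta_1=\{(x,y)\in M\times M\mid\theta_1(x)=\theta_1(y)\}$ is the kernel congruence of $\theta_1$, and $M/\ker\theta_1$ is the quotient monoid. A system of representatives of $M/\ker\theta_1$ is a subset of $M$ containing exactly one element of each congruence class. *)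

theory Defs
  imports "HOL-Algebra.Group"
begin

text \<open>
  Semigroups and monoids are HOL-Algebra structures, so all conditions are relativised to the
  carrier; only the carrier and the multiplication are used where a semigroup is meant.
\<close>

definition pentagon_map :: "('a, 'b) monoid_scheme \<Rightarrow> ('a \<Rightarrow> 'a \<Rightarrow> 'a) \<Rightarrow> 'a \<times> 'a \<Rightarrow> 'a \<times> 'a"
  where "pentagon_map X \<theta> = (\<lambda>(x, y). (x \<otimes>\<^bsub>X\<^esub> y, \<theta> x y))"

definition pentagon_solution :: "('a, 'b) monoid_scheme \<Rightarrow> ('a \<Rightarrow> 'a \<Rightarrow> 'a) \<Rightarrow> bool"
  where "pentagon_solution X \<theta> \<longleftrightarrow>
    (\<forall>x\<in>carrier X. \<theta> x \<in> carrier X \<rightarrow> carrier X) \<and>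
    (\<forall>x\<in>carrier X. \<forall>y\<in>carrier X. \<forall>z\<in>carrier X.
       \<theta> x y \<otimes>\<^bsub>X\<^esub> \<theta> (x \<otimes>\<^bsub>X\<^esub> y) z = \<theta> x (y \<otimes>\<^bsub>X\<^esub> z)) \<and>
    (\<forall>x\<in>carrier X. \<forall>y\<in>carrier X. \<forall>z\<in>carrier X.
       \<theta> (\<theta> x y) (\<theta> (x \<otimes>\<^bsub>X\<^esub> y) z) = \<theta> y z)"

definition idempotent_solution :: "('a, 'b) monoid_scheme \<Rightarrow> ('a \<Rightarrow> 'a \<Rightarrow> 'a) \<Rightarrow> bool"
  where "idempotent_solution X \<theta> \<longleftrightarrow> pentagon_solution X \<theta> \<and>
    (\<forall>p\<in>carrier X \<times> carrier X. pentagon_map X \<theta> (pentagon_map X \<theta> p) = pentagon_map X \<theta> p)"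

definition idempotents :: "('a, 'b) monoid_scheme \<Rightarrow> 'a set"
  where "idempotents M = {e \<in> carrier M. e \<otimes>\<^bsub>M\<^esub> e = e}"

text \<open>The library's \<^const>\<open>hom\<close> only asks for multiplicativity, not for preservation of the identity.\<close>

definition monoid_hom ::
  "('a, 'b) monoid_scheme \<Rightarrow> ('c, 'd) monoid_scheme \<Rightarrow> ('a \<Rightarrow> 'c) set"
  where "monoid_hom M N = {f \<in> hom M N. f \<one>\<^bsub>M\<^esub> = \<one>\<^bsub>N\<^esub>}"

definition kernel_congruence :: "('a, 'b) monoid_scheme \<Rightarrow> ('a \<Rightarrow> 'c) \<Rightarrow> ('a \<times> 'a) set"
  where "kernel_congruence M f = {(x, y) \<in> carrier M \<times> carrier M. f x = f y}"

text \<open>The elements of the quotient monoid are the congruence classes, i.e. \<^term>\<open>carrier M // r\<close>.\<close>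

definition system_of_representatives :: "('a, 'b) monoid_scheme \<Rightarrow> ('a \<times> 'a) set \<Rightarrow> 'a set \<Rightarrow> bool"
  where "system_of_representatives M r S \<longleftrightarrow>
    S \<subseteq> carrier M \<and> (\<forall>C \<in> carrier M // r. \<exists>!x. x \<in> S \<inter> C)"

end

theory Submission
  imports Defs
begin

text \<open>
  Write \<open>f\<close> for \<open>\<theta> \<one>\<close>. Part 1 holds because \<open>f\<close> is an idempotent map: the image of such a map
  meets every class of its kernel in exactly one point, namely the common value of \<open>f\<close> on that
  class. Idempotency of \<open>f\<close> is the second pentagon identity at \<open>x = y = \<one>\<close>, read with \<open>f \<one> = \<one>\<close>.

  Part 2 says \<open>f \<circ> \<theta> x = f\<close>. The second pentagon identity at \<open>y = \<one>\<close> gives \<open>\<theta> e \<circ> \<theta> x = f\<close> for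
  \<open>e = \<theta> x \<one>\<close>, so it is enough that \<open>\<theta> e = f\<close>. This is lemma \<open>theta_at_theta_one\<close>: the idempotency
  of the solution, applied to the idempotent element \<open>e\<close>, forces \<open>\<theta> e \<one> = \<one>\<close>, after which the second
  pentagon identity evaluates \<open>f \<circ> \<theta> e\<close> in two ways, as \<open>f\<close> and as \<open>\<theta> e\<close>.
\<close>

lemma idempotent_map_image_represents:
  assumes closed: "f \<in> carrier M \<rightarrow> carrier M"
    and idem: "\<And>x. x \<in> carrier M \<Longrightarrow> f (f x) = f x"
  shows "system_of_representatives M (kernel_congruence M f) (f ` carrier M)"
  unfolding system_of_representatives_def
proof (intro conjI ballI)
  show "f ` carrier M \<subseteq> carrier M"
    using closed by auto
next
  fix C assume "C \<in> carrier M // kernel_congruence M f"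
  then obtain x where x: "x \<in> carrier M" and C: "C = {y \<in> carrier M. f x = f y}"
    by (auto simp: quotient_def kernel_congruence_def)
  show "\<exists>!y. y \<in> f ` carrier M \<inter> C"
  proof (rule ex1I)
    show "f x \<in> f ` carrier M \<inter> C"
      using x closed idem by (auto simp: C)
  next
    fix y assume "y \<in> f ` carrier M \<inter> C"
    then show "y = f x"
      using idem by (auto simp: C)
  qed
qed

lemma idempotent_solutionD:
  fixes M (structure)
  assumes "idempotent_solution M \<theta>" and "x \<in> carrier M" "y \<in> carrier M"
  shows "\<theta> x y \<in> carrier M"
    and "\<theta> (x \<otimes> y) (\<theta> x y) = \<theta> x y"
    and "z \<in> carrier M \<Longrightarrow> \<theta> x y \<otimes> \<theta> (x \<otimes> y) z = \<theta> x (y \<otimes> z)"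
    and "z \<in> carrier M \<Longrightarrow> \<theta> (\<theta> x y) (\<theta> (x \<otimes> y) z) = \<theta> y z"
  using assms by (auto simp: idempotent_solution_def pentagon_solution_def pentagon_map_def)

context monoid
begin

lemma theta_one_idempotent:
  assumes "idempotent_solution G \<theta>" and "\<theta> \<one> \<one> = \<one>" and "z \<in> carrier G"
  shows "\<theta> \<one> (\<theta> \<one> z) = \<theta> \<one> z"
  using idempotent_solutionD(4)[OF assms(1) one_closed one_closed assms(3)] assms(2) by simp

text \<open>
  This is the second pentagon identity at \<open>y = \<one>\<close>. It exhibits \<open>\<theta> (\<theta> x \<one>)\<close> as an operator
  that turns \<open>\<theta> x\<close> back into \<open>\<theta> \<one>\<close>, independently of \<open>x\<close>.
\<close>

lemma theta_at_theta_one_comp: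
  assumes "idempotent_solution G \<theta>" and "x \<in> carrier G" "z \<in> carrier G"
  shows "\<theta> (\<theta> x \<one>) (\<theta> x z) = \<theta> \<one> z"
  using idempotent_solutionD(4)[OF assms(1,2) one_closed assms(3)] assms(2) by simp

text \<open>
  Both sides equal \<open>\<theta> \<one> (\<theta> e z)\<close> for \<open>e = \<theta> x \<one>\<close>: the index \<open>\<one>\<close> arises once as \<open>\<theta> e \<one>\<close>
  and once as \<open>\<theta> e e\<close>.
\<close>

lemma theta_at_theta_one:
  assumes sol: "idempotent_solution G \<theta>" and one: "\<theta> \<one> \<one> = \<one>"
    and x: "x \<in> carrier G" and z: "z \<in> carrier G"
  shows "\<theta> (\<theta> x \<one>) z = \<theta> \<one> z"
proof -
  define e where "e = \<theta> x \<one>"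
  have e: "e \<in> carrier G"
    unfolding e_def using idempotent_solutionD(1)[OF sol x one_closed] .
  have ee: "e \<otimes> e = e"
    using idempotent_solutionD(3)[OF sol x one_closed one_closed] x by (simp add: e_def)
  have theta_e_e: "\<theta> e e = \<one>"
    using theta_at_theta_one_comp[OF sol x one_closed] one by (simp add: e_def)
  have theta_e_one: "\<theta> e \<one> = \<one>"
    using idempotent_solutionD(2)[OF sol e e] by (simp add: ee theta_e_e)
  have "\<theta> e z = \<theta> \<one> (\<theta> e z)"
    using idempotent_solutionD(4)[OF sol e e z] by (simp add: ee theta_e_e)
  also have "\<dots> = \<theta> \<one> z"
    using theta_at_theta_one_comp[OF sol e z] by (simp add: theta_e_one)
  finally show ?thesis
    by (simp add: e_def)
qed

lemma theta_one_theta: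
  assumes "idempotent_solution G \<theta>" and "\<theta> \<one> \<one> = \<one>"
    and "x \<in> carrier G" "y \<in> carrier G"
  shows "\<theta> \<one> (\<theta> x y) = \<theta> \<one> y"
  using theta_at_theta_one_comp[OF assms(1,3,4)]
    theta_at_theta_one[OF assms(1-3) idempotent_solutionD(1)[OF assms(1,3,4)]]
  by simp

end

theorem theorem20:
  fixes M (structure) and \<theta> :: "'a \<Rightarrow> 'a \<Rightarrow> 'a"
  assumes "monoid M"
    and "idempotent_solution M \<theta>"
    and "\<theta> \<one> \<in> monoid_hom M M"
    and "\<theta> \<one> ` carrier M \<subseteq> idempotents M"
  shows "(system_of_representatives M (kernel_congruence M (\<theta> \<one>)) (\<theta> \<one> ` carrier M)
          \<and> \<one> \<in> \<theta> \<one> ` carrier M)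
       \<and> (\<forall>x\<in>carrier M. \<forall>y\<in>carrier M. (\<theta> x y, y) \<in> kernel_congruence M (\<theta> \<one>))"
proof -
  interpret monoid M by fact
  note sol = assms(2)
  have one: "\<theta> \<one> \<one> = \<one>"
    using assms(3) by (simp add: monoid_hom_def)
  have "system_of_representatives M (kernel_congruence M (\<theta> \<one>)) (\<theta> \<one> ` carrier M)"
    using idempotent_solutionD(1)[OF sol one_closed] theta_one_idempotent[OF sol one]
    by (intro idempotent_map_image_represents) auto
  moreover have "\<one> \<in> \<theta> \<one> ` carrier M"
    using one by (metis image_eqI one_closed)
  moreover have "(\<theta> x y, y) \<in> kernel_congruence M (\<theta> \<one>)"
    if "x \<in> carrier M" "y \<in> carrier M" for x y
    using that idempotent_solutionD(1)[OF sol that] theta_one_theta[OF sol one that]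
    by (simp add: kernel_congruence_def)
  ultimately show ?thesis
    by blast
qed

end
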